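(* At the Nash equilibrium of the load-side Cournot game with loads $\mathcal L=\{1,\dots,L\}$, $L\ge1$, the total day-ahead load and the total real-time load are respectively $$d^{DA*}=\sum_{l\in\mathcal L}d_l^{DA*}=\left(1-\frac{\alpha^{DA}}{(L+1)\alpha^{RT}}\right)\sum_{l\in\mathcal L}d_l,\qquad d^{RT*}=\sum_{l\in\mathcal L}d_l^{RT*}=\frac{\alpha^{DA}}{(L+1)\alpha^{RT}}\sum_{l\in\mathcal L}d_l ,$$ which implies $d>d^{DA*}>\frac{L}{L+1}d$ and $\frac{1}{L+1}d>d^{RT*}>0$, where $d=\sum_{l\in\mathcal L}d_l$. Consequently, at the equilibrium $\lambda^{RT}>\lambda^{DA}$, i.e. the spread $\lambda^{DA}-\lambda^{RT}$ is strictly negative.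
   Context: Let $\mathcal F$ (fast-responsive generators) and $\mathcal S$ (slow-responsive generators) be nonempty finite sets, with cost coefficients $\alpha_i^f>0,\ \beta_i^f\in\mathbb R$ for $i\in\mathcal F$ and $\alpha_j^s>0,\ \beta_j^s\in\mathbb R$ for $j\in\mathcal S$ (quadratic costs $\frac{\alpha}{2}x^2+\beta x$). Define $$\alpha^{DA}=\Big(\sum_{i\in\mathcal F}\tfrac1{\alpha_i^f}+\sum_{j\in\mathcal S}\tfrac1{\alpha_j^s}\Big)^{-1},\quad \beta^{DA}=\alpha^{DA}\Big(\sum_{i\in\mathcal F}\tfrac{\beta_i^f}{\alpha_i^f}+\sum_{j\in\mathcal S}\tfrac{\beta_j^s}{\alpha_j^s}\Big),\quad \alpha^{RT}=\Big(\sum_{i\in\mathcal F}\tfrac1{\alpha_i^f}\Big)^{-1}.$$ In particular $\alpha^{RT}>\alpha^{DA}>0$. (Generator nonnegativity constraints are assumed throughout not to be binding, so the price formulas below hold.) Load-side Cournot game. The players are the loads $l\in\mathcal L=\{1,\dots,L\}$; load $l$ has inelastic demand $d_l\ge 0$, and the total load $d=\sum_{l\in\mathcal L}d_l$ satisfies $d>0$. A strategy of load $l$ is a pair $\vec d_l=(d_l^{DA},d_l^{RT})$ of real numbers with $d_l^{DA}\ge 0$ and $d_l^{DA}+d_l^{RT}=d_l$ (so $d_l^{RT}$ may have any sign). Given a strategy profile $\vec d=(\vec d_l)_{l\in\mathcal L}$, put $d^{DA}=\sum_{l\in\mathcal L}d_l^{DA}$, $d^{RT}=\sum_{l\in\mathcal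 L}d_l^{RT}$; the day-ahead and real-time prices are $$\lambda^{DA}(\vec d)=\alpha^{DA}d^{DA}+\beta^{DA},\qquad \lambda^{RT}(\vec d)=\alpha^{RT}d^{RT}+\lambda^{DA}(\vec d).$$ The cost of load $l$ is $c_l(\vec d_l;\vec d_{-l})=\lambda^{DA}(\vec d)\,d_l^{DA}+\lambda^{RT}(\vec d)\,d_l^{RT}$, where $\vec d_{-l}$ denotes the strategies of all loads other than $l$. A profile $\vec d^*$ of strategies is a Nash equilibrium if $c_l(\vec d^*_l;\vec d^*_{-l})\le c_l(\vec d_l;\vec d^*_{-l})$ for every strategy $\vec d_l$ of load $l$ and every $l\in\mathcal L$. The game has a unique Nash equilibrium; it is the one referred to in the claim. *)

theory Defs
  imports Complex_Main "HOL-Library.FuncSet"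
begin

text \<open>
  Generators are elements of finite sets F (fast-responsive) and S (slow-responsive).
  A generator with coefficients a, b has production cost (a/2) x^2 + b x; the following
  are the coefficients of the aggregate day-ahead supply (all generators) and real-time
  supply (fast generators only), nonnegativity of production not being binding.
\<close>

definition alpha_DA ::
  "'f set \<Rightarrow> ('f \<Rightarrow> real) \<Rightarrow> 's set \<Rightarrow> ('s \<Rightarrow> real) \<Rightarrow> real" where
  "alpha_DA F af S as = inverse ((\<Sum>i\<in>F. 1 / af i) + (\<Sum>j\<in>S. 1 / as j))"

definition beta_DA ::
  "'f set \<Rightarrow> ('f \<Rightarrow> real) \<Rightarrow> ('f \<Rightarrow> real) \<Rightarrow>
   's set \<Rightarrow> ('s \<Rightarrow> real) \<Rightarrow> ('s \<Rightarrow> real) \<Rightarrow> real" where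
  "beta_DA F af bf S as bs =
     alpha_DA F af S as * ((\<Sum>i\<in>F. bf i / af i) + (\<Sum>j\<in>S. bs j / as j))"

definition alpha_RT :: "'f set \<Rightarrow> ('f \<Rightarrow> real) \<Rightarrow> real" where
  "alpha_RT F af = inverse (\<Sum>i\<in>F. 1 / af i)"

text \<open>
  The loads are 1, ..., L. A strategy is a pair (day-ahead load, real-time load). Profiles are
  extensional functions on the set of loads, so that equality of profiles is equality of the
  strategies of all loads.
\<close>

type_synonym strategy = "real \<times> real"
type_synonym profile = "nat \<Rightarrow> strategy"

definition strategies :: "real \<Rightarrow> strategy set" where
  "strategies dl = {(x, y). 0 \<le> x \<and> x + y = dl}"

definition profiles :: "nat \<Rightarrow> (nat \<Rightarrow> real) \<Rightarrow> profile set" where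
  "profiles L d = (\<Pi>\<^sub>E l\<in>{1..L}. strategies (d l))"

definition total_DA :: "nat \<Rightarrow> profile \<Rightarrow> real" where
  "total_DA L p = (\<Sum>l\<in>{1..L}. fst (p l))"

definition total_RT :: "nat \<Rightarrow> profile \<Rightarrow> real" where
  "total_RT L p = (\<Sum>l\<in>{1..L}. snd (p l))"

definition price_DA :: "real \<Rightarrow> real \<Rightarrow> nat \<Rightarrow> profile \<Rightarrow> real" where
  "price_DA aDA bDA L p = aDA * total_DA L p + bDA"

definition price_RT :: "real \<Rightarrow> real \<Rightarrow> real \<Rightarrow> nat \<Rightarrow> profile \<Rightarrow> real" where
  "price_RT aDA bDA aRT L p = aRT * total_RT L p + price_DA aDA bDA L p"

definition load_cost ::
  "real \<Rightarrow> real \<Rightarrow> real \<Rightarrow> nat \<Rightarrow> nat \<Rightarrow> profile \<Rightarrow> real" where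
  "load_cost aDA bDA aRT L l p =
     price_DA aDA bDA L p * fst (p l) + price_RT aDA bDA aRT L p * snd (p l)"

definition nash_equilibrium ::
  "real \<Rightarrow> real \<Rightarrow> real \<Rightarrow> nat \<Rightarrow> (nat \<Rightarrow> real) \<Rightarrow> profile \<Rightarrow> bool" where
  "nash_equilibrium aDA bDA aRT L d p \<longleftrightarrow>
     p \<in> profiles L d \<and>
     (\<forall>l\<in>{1..L}. \<forall>s\<in>strategies (d l).
        load_cost aDA bDA aRT L l p \<le> load_cost aDA bDA aRT L l (p(l := s)))"

end

theory Submission
  imports Defs
begin

text \<open>
  Since the day-ahead and real-time loads of load \<open>l\<close> add up to \<open>d l\<close>, a change of its real-time
  load by \<open>t\<close> changes its cost by \<open>t * (aRT * (Y + y) - aDA * d l) + aRT * t\<^sup>2\<close>, where \<open>Y\<close> is the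
  total real-time load and \<open>y\<close> that of \<open>l\<close>. The constraint of nonnegative day-ahead load cannot
  bind at equilibrium: if it did for one load, \<open>Y \<le> 0\<close> would follow, then \<open>aRT * y \<ge> aDA * d l\<close>
  for every load, and summation would give \<open>Y > 0\<close>. Thus the first-order
  conditions \<open>aRT * (Y + y) = aDA * d l\<close> hold for all loads; summing them determines \<open>Y\<close> and with it
  the profile.
\<close>

section \<open>Supply slopes and unilateral deviations\<close>

lemma alpha_DA_pos_less_alpha_RT:
  assumes "finite F" and "F \<noteq> {}" and "finite S" and "S \<noteq> {}"
    and "\<And>i. i \<in> F \<Longrightarrow> af i > 0" and "\<And>j. j \<in> S \<Longrightarrow> as j > 0"
  shows "0 < alpha_DA F af S as" and "alpha_DA F af S as < alpha_RT F af"
proof -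
  have "0 < (\<Sum>i\<in>F. 1 / af i)" "0 < (\<Sum>j\<in>S. 1 / as j)"
    using assms by (auto intro!: sum_pos)
  \<comment> \<open>The sum over \<open>S\<close> is positive, so the sum inverted in
    \<open>alpha_DA\<close> strictly exceeds the one inverted in \<open>alpha_RT\<close>.\<close>
  then show "0 < alpha_DA F af S as" "alpha_DA F af S as < alpha_RT F af"
    unfolding alpha_DA_def alpha_RT_def by (auto intro!: less_imp_inverse_less)
qed

lemma profilesD:
  assumes "p \<in> profiles L d" and "l \<in> {1..L}"
  shows "0 \<le> fst (p l)" and "fst (p l) + snd (p l) = d l"
  using PiE_mem[OF assms[unfolded profiles_def]] by (auto simp: strategies_def split_beta)

lemma total_DA_add_total_RT:
  assumes "p \<in> profiles L d"
  shows "total_DA L p + total_RT L p = (\<Sum>l\<in>{1..L}. d l)"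
  unfolding total_DA_def total_RT_def sum.distrib[symmetric]
  by (intro sum.cong refl profilesD(2)[OF assms])

lemma total_upd:
  assumes "l \<in> {1..L}"
  shows "total_DA L (p(l := s)) = total_DA L p + (fst s - fst (p l))"
    and "total_RT L (p(l := s)) = total_RT L p + (snd s - snd (p l))"
  using assms by (simp_all add: total_DA_def total_RT_def sum.remove[of _ l])

text \<open>The cost is the day-ahead price times \<open>d l\<close>, plus \<open>aRT\<close> times
  the total and the own real-time load. The day-ahead total falls by what the real-time total gains,
  so the first term changes linearly, the second quadratically, and \<open>bDA\<close>
  cancels.\<close>

lemma load_cost_upd:
  assumes "p \<in> profiles L d" and "l \<in> {1..L}" and "s \<in> strategies (d l)"
  shows "load_cost aDA bDA aRT L l (p(l := s)) = load_cost aDA bDA aRT L l p +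
    (snd s - snd (p l)) * (aRT * (total_RT L p + snd (p l)) - aDA * d l) +
    aRT * (snd s - snd (p l))\<^sup>2"
proof -
  have p: "fst (p l) = d l - snd (p l)"
    using profilesD(2)[OF assms(1,2)] by simp
  have s: "fst s = d l - snd s"
    using assms(3) by (auto simp: strategies_def)
  show ?thesis
    unfolding load_cost_def price_RT_def price_DA_def total_upd[OF assms(2)] fun_upd_same p s
    by (simp add: algebra_simps power2_eq_square)
qed

section \<open>First-order conditions at equilibrium\<close>

lemma nash_equilibriumI:
  assumes "0 \<le> aRT" and "p \<in> profiles L d"
    and "\<And>l. l \<in> {1..L} \<Longrightarrow> aRT * (total_RT L p + snd (p l)) = aDA * d l"
  shows "nash_equilibrium aDA bDA aRT L d p"
  unfolding nash_equilibrium_def using assms by (simp add: load_cost_upd)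

text \<open>Real-time load can be lowered without limit but raised by at most
  \<open>fst (p l)\<close>. Hence the cost slope is never positive, and it vanishes once there is
  room to move both ways.\<close>

lemma nash_equilibrium_gradient:
  assumes "0 < aRT" and "nash_equilibrium aDA bDA aRT L d p" and l: "l \<in> {1..L}"
  shows "aRT * (total_RT L p + snd (p l)) \<le> aDA * d l"
    and "fst (p l) \<noteq> 0 \<Longrightarrow> aRT * (total_RT L p + snd (p l)) = aDA * d l"
proof -
  define g where "g = aRT * (total_RT L p + snd (p l)) - aDA * d l"
  have p: "p \<in> profiles L d"
    using assms(2) by (simp add: nash_equilibrium_def)
  \<comment> \<open>Here \<open>t\<close> is the increase in real-time load; its bound says that the
    new day-ahead load is nonnegative.\<close>
  have dev: "0 \<le> t * (g + aRT * t)" if "t \<le> fst (p l)" for t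
  proof -
    let ?s = "(fst (p l) - t, snd (p l) + t)"
    have s: "?s \<in> strategies (d l)"
      using that profilesD[OF p l] by (simp add: strategies_def)
    then have "load_cost aDA bDA aRT L l p \<le> load_cost aDA bDA aRT L l (p(l := ?s))"
      using assms(2) l by (simp add: nash_equilibrium_def)
    then show ?thesis
      unfolding load_cost_upd[OF p l s] by (simp add: g_def algebra_simps power2_eq_square)
  qed
  \<comment> \<open>For positive \<open>g\<close> the unconstrained minimizer
    \<open>- (g / (2 * aRT))\<close> of \<open>t * (g + aRT * t)\<close> is negative, hence
    admissible, and makes the product negative.\<close>
  have g: "g \<le> 0"
  proof (rule ccontr)
    assume "\<not> g \<le> 0"
    then have "g * g > 0" by simp
    moreover from \<open>\<not> g \<le> 0\<close> have "0 \<le> - (g / (2 * aRT)) * (g + aRT * - (g / (2 * aRT)))"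
      using assms(1) profilesD(1)[OF p l]
      by (intro dev) (auto intro: order_trans[of _ 0])
    moreover have "g + aRT * - (g / (2 * aRT)) = g / 2"
      using assms(1) by (simp add: field_simps)
    ultimately show False
      using assms(1) by (simp add: divide_le_0_iff)
  qed
  then show "aRT * (total_RT L p + snd (p l)) \<le> aDA * d l"
    by (simp add: g_def)
  assume "fst (p l) \<noteq> 0"
  then have pos: "0 < fst (p l)"
    using profilesD(1)[OF p l] by simp
  have "g = 0"
  proof (rule ccontr)
    assume "g \<noteq> 0"
    \<comment> \<open>The minimizer is now positive and may violate the bound, so it is truncated;
      any smaller positive \<open>t\<close> still keeps \<open>g + aRT * t\<close> at most
      \<open>g / 2\<close>.\<close>
    define t where "t = min (fst (p l)) (- g / (2 * aRT))"
    have t: "0 < t" "t \<le> fst (p l)" "t \<le> - g / (2 * aRT)"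
      using pos g \<open>g \<noteq> 0\<close> assms(1) by (auto simp: t_def divide_neg_pos)
    then have "aRT * t \<le> - g / 2"
      using assms(1) by (simp add: field_simps)
    then have "t * (g + aRT * t) < 0"
      using t(1) g \<open>g \<noteq> 0\<close> by (intro mult_pos_neg) auto
    with dev[OF t(2)] show False by simp
  qed
  then show "aRT * (total_RT L p + snd (p l)) = aDA * d l"
    by (simp add: g_def)
qed

lemma nash_equilibrium_interior:
  assumes a: "0 < aDA" "aDA < aRT" and nash: "nash_equilibrium aDA bDA aRT L d p"
    and d: "\<And>l. l \<in> {1..L} \<Longrightarrow> 0 \<le> d l" and D: "0 < (\<Sum>l\<in>{1..L}. d l)"
    and l: "l \<in> {1..L}"
  shows "fst (p l) \<noteq> 0"
proof
  have r: "0 < aRT" using a by simp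
  have p: "p \<in> profiles L d"
    using nash by (simp add: nash_equilibrium_def)
  note grad = nash_equilibrium_gradient[OF r nash]
  let ?Y = "total_RT L p"
  assume "fst (p l) = 0"
  then have "snd (p l) = d l"
    using profilesD(2)[OF p l] by simp
  then have "aRT * ?Y \<le> (aDA - aRT) * d l"
    using grad(1)[OF l] by (simp add: algebra_simps)
  also have "\<dots> \<le> 0"
    using a d[OF l] by (simp add: mult_nonpos_nonneg)
  finally have Y: "?Y \<le> 0"
    using r by (simp add: mult_le_0_iff)
  \<comment> \<open>A load at the bound buys all of \<open>d m\<close> in real time, and
    \<open>aDA < aRT\<close> suffices; otherwise its first-order condition combines with
    \<open>Y\<close>.\<close>
  have lower: "aDA * d m \<le> aRT * snd (p m)" if m: "m \<in> {1..L}" for m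
  proof (cases "fst (p m) = 0")
    case True
    then have "snd (p m) = d m"
      using profilesD(2)[OF p m] by simp
    then show ?thesis
      using a d[OF m] by (simp add: mult_right_mono)
  next
    case False
    moreover have "aRT * ?Y \<le> 0"
      using Y r by (simp add: mult_le_0_iff)
    ultimately show ?thesis
      using grad(2)[OF m] by (simp add: algebra_simps)
  qed
  have "0 < aDA * (\<Sum>m\<in>{1..L}. d m)"
    using a D by simp
  also have "\<dots> \<le> aRT * ?Y"
    unfolding total_RT_def sum_distrib_left by (intro sum_mono lower)
  also have "\<dots> \<le> 0"
    using Y r by (simp add: mult_le_0_iff)
  finally show False by simp
qed

section \<open>Solving the first-order conditions\<close>

lemma total_RT_first_order:
  assumes "aRT \<noteq> 0"
    and "\<And>l. l \<in> {1..L} \<Longrightarrow> aRT * (total_RT L p + snd (p l)) = aDA * d l"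
  shows "total_RT L p = aDA / aRT * ((\<Sum>l\<in>{1..L}. d l) / (real L + 1))"
proof -
  have "aDA * (\<Sum>l\<in>{1..L}. d l) = (\<Sum>l\<in>{1..L}. aRT * (total_RT L p + snd (p l)))"
    unfolding sum_distrib_left by (rule sum.cong[OF refl assms(2)[symmetric]])
  \<comment> \<open>Each of the \<open>L\<close> summands contains the total once, and the
    individual loads add up to it once more: hence the factor \<open>L + 1\<close>.\<close>
  also have "\<dots> = aRT * (real L * total_RT L p + total_RT L p)"
    by (simp add: sum_distrib_left[symmetric] sum.distrib) (simp add: total_RT_def)
  finally have "aDA * (\<Sum>l\<in>{1..L}. d l) = (real L + 1) * aRT * total_RT L p"
    by (simp add: algebra_simps)
  moreover have "(real L + 1) * aRT \<noteq> 0"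
    using assms(1) by (simp add: add_nonneg_eq_0_iff)
  ultimately show ?thesis
    by (simp add: field_simps)
qed

text \<open>Solution of the first-order condition of load \<open>l\<close> for its own real-time
  load, with the total from \<open>total_RT_first_order\<close> inserted.\<close>

definition equilibrium_RT :: "real \<Rightarrow> real \<Rightarrow> nat \<Rightarrow> (nat \<Rightarrow> real) \<Rightarrow> nat \<Rightarrow> real" where
  "equilibrium_RT aDA aRT L d l = aDA / aRT * (d l - (\<Sum>m\<in>{1..L}. d m) / (real L + 1))"

text \<open>Restriction to \<open>{1..L}\<close> makes it extensional, so that uniqueness is
  equality of functions.\<close>

definition equilibrium_profile :: "real \<Rightarrow> real \<Rightarrow> nat \<Rightarrow> (nat \<Rightarrow> real) \<Rightarrow> profile" where
  "equilibrium_profile aDA aRT L d =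
     (\<lambda>l\<in>{1..L}. (d l - equilibrium_RT aDA aRT L d l, equilibrium_RT aDA aRT L d l))"

text \<open>Consistency check: the total presupposed in \<open>equilibrium_RT\<close> is the one
  that actually results.\<close>

lemma total_RT_equilibrium_profile:
  "total_RT L (equilibrium_profile aDA aRT L d) =
     aDA / aRT * ((\<Sum>l\<in>{1..L}. d l) / (real L + 1))"
proof -
  have "total_RT L (equilibrium_profile aDA aRT L d) =
      (\<Sum>l\<in>{1..L}. equilibrium_RT aDA aRT L d l)"
    unfolding total_RT_def equilibrium_profile_def by (intro sum.cong) auto
  also have "\<dots> = aDA / aRT * ((\<Sum>l\<in>{1..L}. d l) - real L * ((\<Sum>l\<in>{1..L}. d l) / (real L + 1)))"
    unfolding equilibrium_RT_def sum_distrib_left[symmetric] sum_subtractf by simp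
  also have "(\<Sum>l\<in>{1..L}. d l) - real L * ((\<Sum>l\<in>{1..L}. d l) / (real L + 1)) =
      (\<Sum>l\<in>{1..L}. d l) / (real L + 1)"
    by (simp add: field_simps)
  finally show ?thesis .
qed

lemma nash_equilibrium_iff:
  assumes a: "0 < aDA" "aDA < aRT"
    and d: "\<And>l. l \<in> {1..L} \<Longrightarrow> 0 \<le> d l" and D: "0 < (\<Sum>l\<in>{1..L}. d l)"
  shows "nash_equilibrium aDA bDA aRT L d p \<longleftrightarrow> p = equilibrium_profile aDA aRT L d"
proof
  have r: "0 < aRT" using a by simp
  assume nash: "nash_equilibrium aDA bDA aRT L d p"
  then have p: "p \<in> profiles L d"
    by (simp add: nash_equilibrium_def)
  have foc: "aRT * (total_RT L p + snd (p l)) = aDA * d l" if "l \<in> {1..L}" for l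
    by (intro nash_equilibrium_gradient(2)[OF r nash that]
        nash_equilibrium_interior[OF a nash d D that])
  have RT: "total_RT L p = aDA / aRT * ((\<Sum>l\<in>{1..L}. d l) / (real L + 1))"
    using r by (intro total_RT_first_order foc) auto
  show "p = equilibrium_profile aDA aRT L d"
  proof
    fix l
    show "p l = equilibrium_profile aDA aRT L d l"
    proof (cases "l \<in> {1..L}")
      case True
      have "snd (p l) = aDA / aRT * d l - total_RT L p"
        using foc[OF True] r by (simp add: field_simps)
      then have "snd (p l) = equilibrium_RT aDA aRT L d l"
        unfolding RT equilibrium_RT_def right_diff_distrib .
      with True profilesD(2)[OF p True] show ?thesis
        by (simp add: equilibrium_profile_def prod_eq_iff)
    next
      case False
      with p have "p l = undefined"
        unfolding profiles_def by (rule PiE_arb)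
      with False show ?thesis
        unfolding equilibrium_profile_def by auto
    qed
  qed
next
  have r: "0 < aRT" using a by simp
  \<comment> \<open>Nonnegative day-ahead load of the candidate: dropping the subtracted average
    only increases the term, and \<open>aDA / aRT\<close> is below 1.\<close>
  have feasible: "equilibrium_RT aDA aRT L d l \<le> d l" if "l \<in> {1..L}" for l
  proof -
    have "equilibrium_RT aDA aRT L d l \<le> aDA / aRT * d l"
      unfolding equilibrium_RT_def using a r D by (intro mult_left_mono) auto
    also have "\<dots> \<le> 1 * d l"
      using a r d[OF that] by (intro mult_right_mono) auto
    finally show ?thesis by simp
  qed
  assume "p = equilibrium_profile aDA aRT L d"
  moreover have "equilibrium_profile aDA aRT L d \<in> profiles L d"
    using feasible
    unfolding profiles_def equilibrium_profile_def strategies_def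
    by (intro restrict_PiE_iff[THEN iffD2]) auto
  moreover have "aRT * (total_RT L (equilibrium_profile aDA aRT L d) +
      snd (equilibrium_profile aDA aRT L d l)) = aDA * d l" if "l \<in> {1..L}" for l
  proof -
    have "snd (equilibrium_profile aDA aRT L d l) = equilibrium_RT aDA aRT L d l"
      using that by (simp add: equilibrium_profile_def)
    then show ?thesis
      unfolding total_RT_equilibrium_profile using r
      by (simp only: equilibrium_RT_def distrib_left[symmetric]) simp
  qed
  ultimately show "nash_equilibrium aDA bDA aRT L d p"
    using r by (intro nash_equilibriumI) auto
qed

section \<open>Equilibrium totals and the price spread\<close>

theorem corollary1:
  fixes F :: "'f set" and S :: "'s set"
    and af bf :: "'f \<Rightarrow> real" and as bs :: "'s \<Rightarrow> real"
    and L :: nat and d :: "nat \<Rightarrow> real"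
    and aDA bDA aRT dtot :: real
  assumes "finite F" and "F \<noteq> {}" and "finite S" and "S \<noteq> {}"
    and "\<And>i. i \<in> F \<Longrightarrow> af i > 0"
    and "\<And>j. j \<in> S \<Longrightarrow> as j > 0"
    and "aDA = alpha_DA F af S as"
    and "bDA = beta_DA F af bf S as bs"
    and "aRT = alpha_RT F af"
    and "L \<ge> 1"
    and "\<And>l. l \<in> {1..L} \<Longrightarrow> d l \<ge> 0"
    and "dtot = (\<Sum>l\<in>{1..L}. d l)"
    and "dtot > 0"
  shows "(\<exists>!p. nash_equilibrium aDA bDA aRT L d p) \<and>
    (\<forall>p. nash_equilibrium aDA bDA aRT L d p \<longrightarrow>
       total_DA L p = (1 - aDA / ((real L + 1) * aRT)) * dtot \<and>
       total_RT L p = aDA / ((real L + 1) * aRT) * dtot \<and>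
       dtot > total_DA L p \<and> total_DA L p > real L / (real L + 1) * dtot \<and>
       1 / (real L + 1) * dtot > total_RT L p \<and> total_RT L p > 0 \<and>
       price_RT aDA bDA aRT L p > price_DA aDA bDA L p \<and>
       price_DA aDA bDA L p - price_RT aDA bDA aRT L p < 0)"
proof -
  have a: "0 < aDA" "aDA < aRT"
    unfolding assms(7,9) using assms(1-6) by (intro alpha_DA_pos_less_alpha_RT; simp)+
  then have r: "0 < aRT" by simp
  have nash_iff:
    "nash_equilibrium aDA bDA aRT L d p \<longleftrightarrow> p = equilibrium_profile aDA aRT L d" for p
    using assms(11-13) by (intro nash_equilibrium_iff a) auto
  have ex1: "\<exists>!p. nash_equilibrium aDA bDA aRT L d p"
    by (simp add: nash_iff)
  \<comment> \<open>The fraction of the total load bought in real time; \<open>aDA < aRT\<close>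
    puts it below \<open>1 / (L + 1)\<close>.\<close>
  define c where "c = aDA / ((real L + 1) * aRT)"
  have "c = aDA / aRT / (real L + 1)"
    by (simp add: c_def mult.commute)
  also have "\<dots> < 1 / (real L + 1)"
    using a r by (intro divide_strict_right_mono) auto
  finally have "c < 1 / (real L + 1)" .
  then have upper: "c * dtot < 1 / (real L + 1) * dtot"
    using assms(13) by (rule mult_strict_right_mono)
  have lower: "0 < c * dtot"
    using a r assms(13) by (simp add: c_def)
  \<comment> \<open>In this form the lower bound on the day-ahead total is \<open>upper\<close>
    subtracted from \<open>dtot\<close>.\<close>
  have split: "real L / (real L + 1) * dtot = dtot - 1 / (real L + 1) * dtot"
    by (simp add: field_simps)
  have RT: "total_RT L p = c * dtot" and DA: "total_DA L p = (1 - c) * dtot"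
    if nash: "nash_equilibrium aDA bDA aRT L d p" for p
  proof -
    show RT: "total_RT L p = c * dtot"
      using nash unfolding nash_iff c_def assms(12)
      by (simp add: total_RT_equilibrium_profile mult.commute)
    have "p \<in> profiles L d"
      using nash by (simp add: nash_equilibrium_def)
    then show "total_DA L p = (1 - c) * dtot"
      using RT total_DA_add_total_RT[of p L d] assms(12) by (simp add: algebra_simps)
  qed
  \<comment> \<open>The prices differ by \<open>aRT\<close> times the total real-time load, which is
    positive.\<close>
  have spread: "price_DA aDA bDA L p < price_RT aDA bDA aRT L p"
    if "nash_equilibrium aDA bDA aRT L d p" for p
    using RT[OF that] lower r by (simp add: price_RT_def)
  show ?thesis
    unfolding c_def[symmetric] split
    using ex1 RT DA spread upper lower by (auto simp: left_diff_distrib)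
qed

end
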